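(* Let $n\ge 1$ and let $A\subset C_n=\{0,1\}^n$ be a non-empty set. Let $$\Delta(A)=\frac{1}{2^n}\sum_{x\in C_n}\operatorname{dist}(x,A),\qquad \rho=\frac12-\frac{\Delta(A)}{n}.$$ Then $$1-H\Bigl(\frac12-\rho\Bigr)\le \frac{\log_2|A|}{n}\le H(\rho).$$
   Context: $C_n=\{0,1\}^n$ is the Boolean cube. For $a=(\alpha_1,\dots,\alpha_n)$, $b=(\beta_1,\dots,\beta_n)\in C_n$ the Hamming distance is $\operatorname{dist}(a,b)=|\{i:\alpha_i\ne\beta_i\}|$, and for non-empty $B\subset C_n$, $\operatorname{dist}(a,B)=\min_{b\in B}\operatorname{dist}(a,b)$. The entropy function is $H(x)=x\log_2\frac1x+(1-x)\log_2\frac1{1-x}$ for $0\le x\le 1/2$, with $H(0)=0$. (For non-empty $A$ one has $0\le\rho\le 1/2$.) *)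

theory Defs
  imports Complex_Main
begin

(* Points of {0,1}^n are Boolean lists of length n; coordinate i of a is a ! i, for i < n. *)
definition cube :: "nat \<Rightarrow> bool list set" where
  "cube n = {a. length a = n}"

(* Meant for lists of equal length only. *)
definition hamming :: "bool list \<Rightarrow> bool list \<Rightarrow> nat" where
  "hamming a b = card {i. i < length a \<and> a ! i \<noteq> b ! i}"

(* Meant for finite non-empty B, which holds for every non-empty subset of a cube. *)
definition dist_set :: "bool list \<Rightarrow> bool list set \<Rightarrow> nat" where
  "dist_set a B = Min (hamming a ` B)"

definition avg_dist :: "nat \<Rightarrow> bool list set \<Rightarrow> real" where
  "avg_dist n A = 1 / 2 ^ n * (\<Sum>x\<in>cube n. real (dist_set x A))"

(* Binary entropy; only its values on the interval [0, 1/2] matter. *)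
definition entropy2 :: "real \<Rightarrow> real" where
  "entropy2 x = (if x = 0 then 0
     else x * log 2 (1 / x) + (1 - x) * log 2 (1 / (1 - x)))"

end

theory Submission
  imports Defs
begin

text \<open>
  For \<open>0 \<le> p \<le> 1/2\<close>, \<open>n * entropy2 p\<close> is the infimum over \<open>0 < t \<le> 1\<close> of \<open>n * log 2 (1 + t) - n * p * log 2 t\<close>,
  so both bounds reduce to inequalities \<open>K * t powr (n * p) \<le> (1 + t) ^ n\<close>.
  Let \<open>\<Delta>\<close> be the average distance to \<open>A\<close>. For the lower bound, sum
  \<open>t ^ dist(x, A) \<le> (\<Sum>a\<in>A. t ^ dist(x, a))\<close> over \<open>x\<close> and use Jensen's inequality on the left to get
  \<open>2 ^ n * t powr \<Delta> \<le> card A * (1 + t) ^ n\<close>. For the upper bound, split \<open>A\<close> by the first coordinate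
  into \<open>A\<^sub>0\<close> and \<open>A\<^sub>1\<close>: since \<open>\<Delta>(A) \<le> (\<Delta>(A\<^sub>0) + \<Delta>(A\<^sub>1)) / 2\<close> and \<open>\<Delta>(A) \<le> \<Delta>(A\<^sub>i) + 1/2\<close>,
  induction on \<open>n\<close> gives \<open>card A * t powr (n / 2 - \<Delta>) \<le> (1 + t) ^ n\<close>.
\<close>

section \<open>Recursion of the cube and of Hamming distance on the first coordinate\<close>

lemma cube_0: "cube 0 = {[]}"
  by (auto simp: cube_def)

lemma cube_Suc: "cube (Suc n) = Cons True ` cube n \<union> Cons False ` cube n"
proof
  show "cube (Suc n) \<subseteq> Cons True ` cube n \<union> Cons False ` cube n"
  proof
    fix x assume "x \<in> cube (Suc n)"
    then obtain b y where "x = b # y" "y \<in> cube n"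
      by (auto simp: cube_def length_Suc_conv)
    then show "x \<in> Cons True ` cube n \<union> Cons False ` cube n"
      by (cases b) auto
  qed
qed (auto simp: cube_def)

lemma finite_cube: "finite (cube n)"
  by (induction n) (auto simp: cube_0 cube_Suc)

lemma sum_cube_Suc:
  "sum f (cube (Suc n)) = (\<Sum>x\<in>cube n. f (True # x)) + (\<Sum>x\<in>cube n. f (False # x))"
proof -
  have "sum f (cube (Suc n)) = sum f (Cons True ` cube n) + sum f (Cons False ` cube n)"
    unfolding cube_Suc by (rule sum.union_disjoint) (auto simp: finite_cube)
  then show ?thesis
    by (simp add: sum.reindex inj_on_def)
qed

lemma card_cube: "card (cube n) = 2 ^ n"
proof (induction n)
  case (Suc n)
  then show ?case using sum_cube_Suc[of "\<lambda>_. 1::nat" n] by simp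
qed (simp add: cube_0)

lemma hamming_Cons: "hamming (x # xs) (y # ys) = (if x = y then 0 else 1) + hamming xs ys"
proof -
  have *: "{i. i < length (x # xs) \<and> (x # xs) ! i \<noteq> (y # ys) ! i} =
     (if x = y then {} else {0}) \<union> Suc ` {i. i < length xs \<and> xs ! i \<noteq> ys ! i}"
    (is "?L = ?R")
  proof (rule set_eqI)
    show "i \<in> ?L \<longleftrightarrow> i \<in> ?R" for i
      by (cases i) auto
  qed
  have "card ((if x = y then {} else {0}) \<union> Suc ` {i. i < length xs \<and> xs ! i \<noteq> ys ! i})
      = card (if x = y then {} else {0::nat}) + card (Suc ` {i. i < length xs \<and> xs ! i \<noteq> ys ! i})"
    by (rule card_Un_disjoint) auto
  then show ?thesis
    unfolding hamming_def * by (simp add: card_image)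
qed

lemma dist_set_le: "finite A \<Longrightarrow> a \<in> A \<Longrightarrow> dist_set x A \<le> hamming x a"
  unfolding dist_set_def by (rule Min_le) auto

lemma dist_set_attained:
  assumes "finite A" "A \<noteq> {}"
  obtains a where "a \<in> A" "dist_set x A = hamming x a"
proof -
  have "dist_set x A \<in> hamming x ` A"
    unfolding dist_set_def using assms by (intro Min_in) auto
  then show thesis using that by blast
qed

section \<open>Slices by the first coordinate and their average distances\<close>

definition slice :: "bool \<Rightarrow> bool list set \<Rightarrow> bool list set" where
  "slice b A = {x. b # x \<in> A}"

lemma slice_subset_cube: "A \<subseteq> cube (Suc n) \<Longrightarrow> slice b A \<subseteq> cube n"
  by (auto simp: slice_def cube_def)

lemma card_slices:
  assumes "A \<subseteq> cube (Suc n)"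
  shows "card A = card (slice True A) + card (slice False A)"
proof -
  have A: "A = Cons True ` slice True A \<union> Cons False ` slice False A"
    using assms unfolding cube_Suc slice_def by auto
  have fin: "finite (slice b A)" for b
    using slice_subset_cube[OF assms] finite_cube finite_subset by blast
  have "card A = card (Cons True ` slice True A) + card (Cons False ` slice False A)"
    by (subst A, rule card_Un_disjoint) (auto simp: fin)
  then show ?thesis by (simp add: card_image)
qed

text \<open>Putting \<open>b\<close> in front of a point of the slice nearest to \<open>x\<close>
  gives a competitor in \<open>A\<close>.\<close>

lemma dist_set_Cons_le:
  assumes "A \<subseteq> cube (Suc n)" "slice b A \<noteq> {}"
  shows "dist_set (c # x) A \<le> (if c = b then 0 else 1) + dist_set x (slice b A)"
proof -
  have "finite A" "finite (slice b A)"
    using assms slice_subset_cube finite_cube finite_subset by metis+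
  then obtain a where a: "a \<in> slice b A" "dist_set x (slice b A) = hamming x a"
    using assms(2) dist_set_attained by blast
  then have "dist_set (c # x) A \<le> hamming (c # x) (b # a)"
    using \<open>finite A\<close> by (intro dist_set_le) (auto simp: slice_def)
  then show ?thesis using a by (simp add: hamming_Cons)
qed

lemma avg_dist_nonneg: "avg_dist n A \<ge> 0"
  unfolding avg_dist_def by (simp add: sum_nonneg)

lemma sum_dist_set: "(\<Sum>x\<in>cube n. real (dist_set x A)) = 2 ^ n * avg_dist n A"
  by (simp add: avg_dist_def)

text \<open>Each point is sent to the slice with its own first coordinate, so that coordinate costs
  nothing.\<close>

lemma avg_dist_le_mean_slices:
  assumes "A \<subseteq> cube (Suc n)" "slice True A \<noteq> {}" "slice False A \<noteq> {}"
  shows "avg_dist (Suc n) A \<le> (avg_dist n (slice True A) + avg_dist n (slice False A)) / 2"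
proof -
  have "(\<Sum>x\<in>cube n. real (dist_set (b # x) A)) \<le> (\<Sum>x\<in>cube n. real (dist_set x (slice b A)))" for b
    using dist_set_Cons_le[OF assms(1), of b b] assms(2,3) by (cases b) (auto intro!: sum_mono)
  from this[of True] this[of False]
  have "2 ^ n * (2 * avg_dist (Suc n) A) \<le> 2 ^ n * (avg_dist n (slice True A) + avg_dist n (slice False A))"
    using sum_cube_Suc[of "\<lambda>x. real (dist_set x A)" n]
    by (simp add: sum_dist_set algebra_simps)
  then have "2 * avg_dist (Suc n) A \<le> avg_dist n (slice True A) + avg_dist n (slice False A)"
    by (subst (asm) mult_le_cancel_left_pos) auto
  then show ?thesis by simp
qed

text \<open>All points are sent to the one slice \<open>b\<close>; exactly half of them pay 1 for a
  wrong first coordinate.\<close>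

lemma avg_dist_le_slice:
  assumes "A \<subseteq> cube (Suc n)" "slice b A \<noteq> {}"
  shows "avg_dist (Suc n) A \<le> avg_dist n (slice b A) + 1 / 2"
proof -
  have le: "(\<Sum>x\<in>cube n. real (dist_set (c # x) A))
      \<le> 2 ^ n * ((if c = b then 0 else 1) + avg_dist n (slice b A))" for c
  proof -
    have "(\<Sum>x\<in>cube n. real (dist_set (c # x) A))
        \<le> (\<Sum>x\<in>cube n. (if c = b then 0 else 1) + real (dist_set x (slice b A)))"
      using dist_set_Cons_le[OF assms, of c] by (intro sum_mono) (fastforce split: if_splits)
    also have "\<dots> = 2 ^ n * ((if c = b then 0 else 1) + avg_dist n (slice b A))"
      by (simp add: sum.distrib card_cube sum_dist_set algebra_simps)
    finally show ?thesis .
  qed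
  have "2 ^ Suc n * avg_dist (Suc n) A \<le> 2 ^ n * (1 + 2 * avg_dist n (slice b A))"
    using add_mono[OF le[of True] le[of False]] unfolding sum_dist_set[symmetric] sum_cube_Suc
    by (cases b) (simp_all add: algebra_simps)
  then have "2 ^ n * (2 * avg_dist (Suc n) A) \<le> 2 ^ n * (1 + 2 * avg_dist n (slice b A))"
    by simp
  then have "2 * avg_dist (Suc n) A \<le> 1 + 2 * avg_dist n (slice b A)"
    by (subst (asm) mult_le_cancel_left_pos) auto
  then show ?thesis by simp
qed

lemma avg_dist_0: "A \<subseteq> cube 0 \<Longrightarrow> A \<noteq> {} \<Longrightarrow> avg_dist 0 A = 0"
  by (auto simp: avg_dist_def cube_0 dist_set_def hamming_def subset_singleton_iff)

lemma slice_nonempty: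
  assumes "A \<subseteq> cube (Suc n)" "A \<noteq> {}"
  shows "\<exists>b. slice b A \<noteq> {}"
proof -
  from assms(2) obtain x where "x \<in> A" by blast
  moreover from this obtain b y where "x = b # y"
    using assms(1) by (auto simp: cube_def length_Suc_conv)
  ultimately show ?thesis by (auto simp: slice_def)
qed

text \<open>This is what makes \<rho> non-negative; each coordinate adds at most 1/2 through a
  non-empty slice.\<close>

lemma avg_dist_le_half: "A \<subseteq> cube n \<Longrightarrow> A \<noteq> {} \<Longrightarrow> avg_dist n A \<le> n / 2"
proof (induction n arbitrary: A)
  case (Suc n)
  obtain b where b: "slice b A \<noteq> {}" using slice_nonempty[OF Suc.prems] by blast
  show ?case
    using avg_dist_le_slice[OF Suc.prems(1) b] Suc.IH[OF slice_subset_cube[OF Suc.prems(1)] b]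
    by (simp add: field_simps)
qed (simp add: avg_dist_0)

section \<open>Upper bound on the size of a set, by induction on the dimension\<close>

text \<open>The inequality behind the induction step: \<open>x\<close> and \<open>y\<close> are the
  exponents of the two slices, \<open>u\<close> that of the whole set. For \<open>x \<le> y\<close>,
  the bound \<open>u \<le> x\<close> suffices once the gap \<open>y - x\<close> is at least 1; for
  smaller gaps the bound by the mean takes over.\<close>

lemma powr_sum_le:
  fixes t u x y :: real
  assumes t: "0 < t" "t \<le> 1" and u: "u \<le> x" "u \<le> y" "u \<le> (x + y - 1) / 2"
  shows "t powr x + t powr y \<le> (1 + t) * t powr u"
proof -
  have *: "t powr x + t powr y \<le> (1 + t) * t powr u"
    if "u \<le> x" "x \<le> y" "u \<le> (x + y - 1) / 2" for x y
  proof (cases "x + 1 \<le> y")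
    case True
    then have "t powr y \<le> t powr (u + 1)" "t powr x \<le> t powr u"
      using t that by (auto intro!: powr_mono')
    then show ?thesis using t by (simp add: powr_add algebra_simps)
  next
    case False
    \<comment> \<open>A gap between 0 and 1 gives \<open>b \<le> 1 \<le> a\<close>, and
      \<open>(a - 1) * (1 - b) \<ge> 0\<close> expands to \<open>1 + a * b \<le> a + b\<close>,
      where \<open>a + b = (1 + t) * a\<close>.\<close>
    define a b where "a = t powr ((y - x - 1) / 2)" and "b = t powr ((y - x + 1) / 2)"
    have "a \<ge> t powr 0" "b \<le> t powr 0"
      unfolding a_def b_def by (rule powr_mono'; use t that False in simp)+
    then have "0 \<le> (a - 1) * (1 - b)" using t by simp
    moreover have "a * b = t powr (y - x)"
      unfolding a_def b_def powr_add[symmetric] by (rule arg_cong[where f="(powr) t"]) argo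
    moreover have "b = t * a"
    proof -
      have "b = t powr (1 + (y - x - 1) / 2)" unfolding b_def by (simp add: field_simps)
      then show ?thesis using t unfolding a_def powr_add by simp
    qed
    ultimately have "1 + t powr (y - x) \<le> (1 + t) * a" by (simp add: algebra_simps)
    then have "t powr x * (1 + t powr (y - x)) \<le> t powr x * ((1 + t) * a)"
      by (rule mult_left_mono) simp
    moreover have "t powr x * (1 + t powr (y - x)) = t powr x + t powr y"
      by (simp add: distrib_left powr_add[symmetric])
    ultimately have "t powr x + t powr y \<le> (1 + t) * (t powr x * a)"
      by (simp add: mult.left_commute)
    also have "t powr x * a = t powr ((x + y - 1) / 2)"
      unfolding a_def powr_add[symmetric] by (simp add: field_simps)
    also have "(1 + t) * \<dots> \<le> (1 + t) * t powr u"
      using t that by (intro mult_left_mono powr_mono') auto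
    finally show ?thesis .
  qed
  show ?thesis
    using *[of x y] *[of y x] u by (cases "x \<le> y") (auto simp: add.commute)
qed

lemma card_le_powr_avg_dist:
  fixes t :: real
  assumes t: "0 < t" "t \<le> 1"
  shows "A \<subseteq> cube n \<Longrightarrow> A \<noteq> {} \<Longrightarrow> card A \<le> (1 + t) ^ n * t powr (avg_dist n A - n / 2)"
proof (induction n arbitrary: A)
  case 0
  then have "A = {[]}" by (auto simp: cube_0)
  then show ?case using avg_dist_0[OF 0] t by simp
next
  case (Suc n)
  \<comment> \<open>Centring at half the dimension absorbs the 1/2 of
    \<open>avg_dist_le_slice\<close>, leaving \<open>u \<le> v b\<close>, and puts the
    \<open>- 1\<close> into the bound by the mean of \<open>v True\<close> and
    \<open>v False\<close>.\<close>
  define u where "u = avg_dist (Suc n) A - Suc n / 2"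
  define v where "v b = avg_dist n (slice b A) - n / 2" for b
  note sub = slice_subset_cube[OF Suc.prems(1)]
  have IH: "card (slice b A) \<le> (1 + t) ^ n * t powr v b" if "slice b A \<noteq> {}" for b
    using Suc.IH[OF sub that] by (simp add: v_def)
  have u: "u \<le> v b" if "slice b A \<noteq> {}" for b
    using avg_dist_le_slice[OF Suc.prems(1) that] by (simp add: u_def v_def field_simps)
  have card: "real (card A) = card (slice True A) + card (slice False A)"
    using card_slices[OF Suc.prems(1)] by simp
  have "card A \<le> (1 + t) ^ n * ((1 + t) * t powr u)"
  \<comment> \<open>Distance to an empty slice has no meaning, so this case uses only the other
    slice, which has as many points as \<open>A\<close>.\<close>
  proof (cases "\<exists>b. slice b A = {}")
    case True
    then obtain b where b: "slice b A = {}" by blast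
    have b': "slice (\<not> b) A \<noteq> {}"
    proof -
      obtain c where "slice c A \<noteq> {}" using slice_nonempty[OF Suc.prems] by blast
      then show ?thesis using b by (cases "c = b") auto
    qed
    have "real (card A) = card (slice (\<not> b) A)"
      using card b by (cases b) auto
    also have "\<dots> \<le> (1 + t) ^ n * t powr v (\<not> b)" by (rule IH[OF b'])
    also have "\<dots> \<le> (1 + t) ^ n * ((1 + t) * t powr u)"
    proof (rule mult_left_mono)
      have "t powr v (\<not> b) \<le> t powr u"
        using u[OF b'] t by (intro powr_mono') auto
      also have "\<dots> \<le> (1 + t) * t powr u" using t by (simp add: algebra_simps)
      finally show "t powr v (\<not> b) \<le> (1 + t) * t powr u" .
    qed (use t in auto)
    finally show ?thesis .
  next
    case False
    then have ne: "slice b A \<noteq> {}" for b by blast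
    have "real (card A) \<le> (1 + t) ^ n * (t powr v True + t powr v False)"
      using IH[OF ne, of True] IH[OF ne, of False] card by (simp add: algebra_simps)
    also have "\<dots> \<le> (1 + t) ^ n * ((1 + t) * t powr u)"
    proof (intro mult_left_mono powr_sum_le t u ne)
      show "u \<le> (v True + v False - 1) / 2"
        using avg_dist_le_mean_slices[OF Suc.prems(1) ne ne] by (simp add: u_def v_def field_simps)
    qed (use t in auto)
    finally show ?thesis .
  qed
  then show ?case by (simp add: u_def mult.assoc mult.left_commute)
qed

section \<open>Lower bound on the size of a set, by summing powers of distances\<close>

text \<open>Each coordinate contributes a factor \<open>1 + t\<close>: 1 for agreement with
  \<open>a\<close>, \<open>t\<close> for disagreement.\<close>

lemma sum_power_hamming:
  fixes t :: real
  shows "a \<in> cube n \<Longrightarrow> (\<Sum>x\<in>cube n. t ^ hamming x a) = (1 + t) ^ n"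
proof (induction n arbitrary: a)
  case (Suc n)
  then obtain b c where a: "a = b # c" "c \<in> cube n"
    by (auto simp: cube_def length_Suc_conv)
  show ?case
    using Suc.IH[OF a(2)]
    by (cases b) (simp_all add: a(1) sum_cube_Suc hamming_Cons sum_distrib_left[symmetric] algebra_simps)
qed (simp add: cube_0 hamming_def)

lemma powr_avg_dist_le_sum:
  fixes t :: real
  assumes t: "0 < t"
  shows "2 ^ n * t powr avg_dist n A \<le> (\<Sum>x\<in>cube n. t ^ dist_set x A)"
proof -
  define m where "m = avg_dist n A"
  \<comment> \<open>Jensen's inequality via the tangent line of \<open>t powr d\<close> at the mean, whose linear part sums to zero.\<close>
  have "t powr m * (1 + (d - m) * ln t) \<le> t ^ d" for d :: nat
  proof -
    have "t powr m * (1 + (d - m) * ln t) \<le> t powr m * exp ((d - m) * ln t)"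
      by (intro mult_left_mono exp_ge_add_one_self) auto
    also have "\<dots> = t powr m * t powr (d - m)" using t by (simp add: powr_def)
    also have "\<dots> = t ^ d" using t by (simp add: powr_add[symmetric] powr_realpow)
    finally show ?thesis .
  qed
  then have "(\<Sum>x\<in>cube n. t powr m * (1 + (dist_set x A - m) * ln t)) \<le> (\<Sum>x\<in>cube n. t ^ dist_set x A)"
    by (intro sum_mono)
  moreover have "(\<Sum>x\<in>cube n. t powr m * (1 + (dist_set x A - m) * ln t)) = 2 ^ n * t powr m"
    by (simp add: sum_distrib_left[symmetric] sum_distrib_right[symmetric] sum.distrib
        sum_subtractf sum_dist_set card_cube m_def)
  ultimately show ?thesis by (simp add: m_def)
qed

lemma powr_avg_dist_le_card:
  fixes t :: real
  assumes t: "0 < t" and A: "A \<subseteq> cube n" "A \<noteq> {}"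
  shows "2 ^ n * t powr avg_dist n A \<le> card A * (1 + t) ^ n"
proof -
  have fin: "finite A" using A finite_cube finite_subset by blast
  have "t ^ dist_set x A \<le> (\<Sum>a\<in>A. t ^ hamming x a)" for x
  proof -
    obtain a where "a \<in> A" "dist_set x A = hamming x a"
      using dist_set_attained[OF fin A(2)] by blast
    then show ?thesis using t fin by (auto intro!: member_le_sum)
  qed
  then have "(\<Sum>x\<in>cube n. t ^ dist_set x A) \<le> (\<Sum>x\<in>cube n. \<Sum>a\<in>A. t ^ hamming x a)"
    by (intro sum_mono)
  also have "\<dots> = (\<Sum>a\<in>A. \<Sum>x\<in>cube n. t ^ hamming x a)" by (rule sum.swap)
  also have "\<dots> = (\<Sum>a\<in>A. (1 + t) ^ n)"
    using A by (intro sum.cong) (auto simp: sum_power_hamming)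
  finally show ?thesis using powr_avg_dist_le_sum[OF t, of n A] by simp
qed

section \<open>From exponential inequalities to entropy\<close>

lemma log_div_le_entropy2:
  fixes K p :: real
  assumes n: "n \<ge> 1" and K: "K > 0" and p: "0 \<le> p" "p \<le> 1 / 2"
    and bound: "\<And>t. 0 < t \<Longrightarrow> t \<le> 1 \<Longrightarrow> K * t powr (n * p) \<le> (1 + t) ^ n"
  shows "log 2 K / n \<le> entropy2 p"
proof (cases "p = 0")
  case True
  \<comment> \<open>At \<open>p = 0\<close> the infimum over \<open>t\<close> is not attained, so
    \<open>t\<close> tends to 0 from the right in \<open>K \<le> (1 + t) ^ n\<close>.\<close>
  have "K \<le> 1"
  proof (rule tendsto_lowerbound)
    show "((\<lambda>t. (1 + t) ^ n) \<longlongrightarrow> (1::real)) (at_right 0)"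
      by (auto intro!: tendsto_eq_intros)
    show "\<forall>\<^sub>F t in at_right 0. K \<le> (1 + t) ^ n"
      unfolding eventually_at_right_field using bound True by (intro exI[of _ 1]) auto
  qed simp
  then show ?thesis using True K n by (simp add: entropy2_def divide_le_0_iff)
next
  case False
  \<comment> \<open>The minimiser of \<open>log 2 (1 + t) - p * log 2 t\<close>; it is at most 1
    because \<open>p \<le> 1 / 2\<close>.\<close>
  define t where "t = p / (1 - p)"
  have t: "0 < t" "t \<le> 1" using p False by (auto simp: t_def field_simps)
  have "log 2 (K * t powr (n * p)) \<le> log 2 ((1 + t) ^ n)"
    using bound[OF t] K t by (intro log_mono) auto
  then have "log 2 K + n * p * log 2 t \<le> n * log 2 (1 + t)"
    using K t by (simp add: log_mult log_powr log_nat_power)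
  then have "log 2 K / n \<le> log 2 (1 + t) - p * log 2 t"
    using n by (simp add: field_simps)
  also have "1 + t = 1 / (1 - p)" using p by (simp add: t_def field_simps)
  also have "log 2 (1 / (1 - p)) - p * log 2 t = entropy2 p"
    using p False by (simp add: entropy2_def t_def log_divide algebra_simps)
  finally show ?thesis .
qed

theorem theorem3p9:
  fixes n :: nat and A :: "bool list set" and \<rho> :: real
  assumes "n \<ge> 1"
    and "A \<subseteq> cube n"
    and "A \<noteq> {}"
    and "\<rho> = 1 / 2 - avg_dist n A / real n"
  shows "1 - entropy2 (1 / 2 - \<rho>) \<le> log 2 (real (card A)) / real n
    \<and> log 2 (real (card A)) / real n \<le> entropy2 \<rho>"
proof
  have card: "card A > 0"
    using assms finite_cube finite_subset by (metis card_gt_0_iff)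
  have \<rho>: "0 \<le> \<rho>" "\<rho> \<le> 1 / 2"
    using avg_dist_le_half[OF assms(2,3)] avg_dist_nonneg[of n A] assms(1)
    unfolding assms(4) by (auto simp: field_simps)
  have avg: "n * (1 / 2 - \<rho>) = avg_dist n A" "n * \<rho> = n / 2 - avg_dist n A"
    using assms(1,4) by (auto simp: field_simps)
  \<comment> \<open>Taking \<open>K\<close> as the inverse density of \<open>A\<close> turns the
    lower bound on \<open>card A\<close> into an upper bound on \<open>K\<close>.\<close>
  have "log 2 (2 ^ n / card A) / n \<le> entropy2 (1 / 2 - \<rho>)"
  proof (rule log_div_le_entropy2)
    fix t :: real assume "0 < t"
    then show "2 ^ n / card A * t powr (n * (1 / 2 - \<rho>)) \<le> (1 + t) ^ n"
      using powr_avg_dist_le_card[OF \<open>0 < t\<close> assms(2,3)] card unfolding avg by (simp add: field_simps)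
  qed (use assms(1) card \<rho> in auto)
  moreover have "log 2 (2 ^ n / card A) / n = 1 - log 2 (card A) / n"
    using assms(1) card by (simp add: log_divide log_nat_power field_simps)
  ultimately show "1 - entropy2 (1 / 2 - \<rho>) \<le> log 2 (card A) / n" by simp
  show "log 2 (card A) / n \<le> entropy2 \<rho>"
  proof (rule log_div_le_entropy2)
    fix t :: real assume t: "0 < t" "t \<le> 1"
    have "card A * t powr (n * \<rho>) \<le> ((1 + t) ^ n * t powr (avg_dist n A - n / 2)) * t powr (n * \<rho>)"
      using card_le_powr_avg_dist[OF t assms(2,3)] by (intro mult_right_mono) auto
    \<comment> \<open>The two exponents of \<open>t\<close> are opposite, since
      \<open>n * \<rho>\<close> equals \<open>n / 2 - avg_dist n A\<close>.\<close>
    also have "\<dots> = (1 + t) ^ n"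
      using t unfolding avg mult.assoc powr_add[symmetric] by simp
    finally show "card A * t powr (n * \<rho>) \<le> (1 + t) ^ n" .
  qed (use assms(1) card \<rho> in auto)
qed

end
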